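(* Let $a,b$ be distinct variables. (i) $\operatorname{Isot}(L_2^1)=\operatorname{Isot}(L_3^1)\sim\{ab\}$. (ii) $\operatorname{Isot}(L_4^1)=\operatorname{Isot}(L_5^1)\sim\{abab,\ a^2b^2,\ ab^2a\}$.
   Context: For $\ell\ge 2$, $L_\ell=\langle a,b\mid aa=a,\ bb=b,\ \underbrace{ababab\cdots}_{\text{length }\ell}=0\rangle$ is the semigroup with zero $0$ generated by two idempotents subject to the relation that the alternating word $abab\cdots$ of length $\ell$ equals $0$; $L_\ell^1$ is the monoid obtained by adjoining an identity element to $L_\ell$. $\mathfrak A$ is a countably infinite alphabet of variables. A word $\mathbf u$ is an isoterm for a semigroup $S$ if $\mathbf u=\mathbf v$ whenever $S$ satisfies the identity $\mathbf u\approx\mathbf v$. For a monoid $M$, $\operatorname{Isot}(M)$ is the set of all words in the free monoid $\mathfrak A^*$ that are isoterms for $M$. For a set of words $W\subseteq\mathfrak A^*$, $S^1(W)$ is the Rees quotient of $\mathfrak A^*$ over the ideal of all words that are not (contiguous) subwords of words in $W$. $\operatorname{var}S$ is the variety of semigroups generated by $S$. Sets of words $W,W'$ are equationally equivalent, written $W\sim W'$, if $\operatorname{var}S^1(W)=\operatorname{var}S^1(W')$. *)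

theory Defs
  imports "HOL-Algebra.Product_Groups" "HOL-Library.Sublist"
begin

text \<open>
  A semigroup is represented by an \<open>HOL-Algebra\<close> monoid record whose field \<open>one\<close> is ignored.
\<close>

definition subsemigroup :: "'a set \<Rightarrow> ('a, 'm) monoid_scheme \<Rightarrow> bool" where
  "subsemigroup H G \<longleftrightarrow>
     H \<noteq> {} \<and> H \<subseteq> carrier G \<and> (\<forall>x\<in>H. \<forall>y\<in>H. x \<otimes>\<^bsub>G\<^esub> y \<in> H)"

definition congruence :: "('a, 'm) monoid_scheme \<Rightarrow> ('a \<times> 'a) set \<Rightarrow> bool" where
  "congruence G \<theta> \<longleftrightarrow> equiv (carrier G) \<theta> \<and>
     (\<forall>(x, y)\<in>\<theta>. \<forall>z\<in>carrier G.
        (x \<otimes>\<^bsub>G\<^esub> z, y \<otimes>\<^bsub>G\<^esub> z) \<in> \<theta> \<and> (z \<otimes>\<^bsub>G\<^esub> x, z \<otimes>\<^bsub>G\<^esub> y) \<in> \<theta>)"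

definition generated_congruence ::
  "('a, 'm) monoid_scheme \<Rightarrow> ('a \<times> 'a) set \<Rightarrow> ('a \<times> 'a) set" where
  "generated_congruence G R = \<Inter> {\<theta>. congruence G \<theta> \<and> R \<subseteq> \<theta>}"

definition quotient_monoid ::
  "('a, 'm) monoid_scheme \<Rightarrow> ('a \<times> 'a) set \<Rightarrow> 'a set monoid" where
  "quotient_monoid G \<theta> =
     \<lparr>carrier = carrier G // \<theta>,
      mult = (\<lambda>X Y. \<Union>x\<in>X. \<Union>y\<in>Y. \<theta> `` {x \<otimes>\<^bsub>G\<^esub> y}),
      one = \<theta> `` {\<one>\<^bsub>G\<^esub>}\<rparr>"

definition rees_congruence :: "('a, 'm) monoid_scheme \<Rightarrow> 'a set \<Rightarrow> ('a \<times> 'a) set" where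
  "rees_congruence G I =
     {(x, y). x \<in> carrier G \<and> y \<in> carrier G \<and> (x = y \<or> x \<in> I \<and> y \<in> I)}"


section \<open>The semigroups \<open>L\<^sub>\<ell>\<close> and the monoids \<open>L\<^sub>\<ell>\<^sup>1\<close>\<close>

datatype gen = Ga | Gb

text \<open>
  The free semigroup with zero: \<open>None\<close> is the zero, and \<open>Some w\<close> is the nonempty word \<open>w\<close>.
\<close>

definition free_semigroup0 :: "'x list option monoid" where
  "free_semigroup0 =
     \<lparr>carrier = insert None (Some ` {w. w \<noteq> []}),
      mult = (\<lambda>x y. case (x, y) of (Some u, Some v) \<Rightarrow> Some (u @ v) | _ \<Rightarrow> None),
      one = undefined\<rparr>"

definition alternating :: "nat \<Rightarrow> gen list" where
  "alternating l = map (\<lambda>i. if even i then Ga else Gb) [0..<l]"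

definition L_relations :: "nat \<Rightarrow> (gen list option \<times> gen list option) set" where
  "L_relations l =
     {(Some [Ga, Ga], Some [Ga]), (Some [Gb, Gb], Some [Gb]), (Some (alternating l), None)}"

definition L :: "nat \<Rightarrow> gen list option set monoid" where
  "L l = quotient_monoid free_semigroup0 (generated_congruence free_semigroup0 (L_relations l))"

definition adjoin_one :: "('a, 'm) monoid_scheme \<Rightarrow> 'a option monoid" where
  "adjoin_one G =
     \<lparr>carrier = insert None (Some ` carrier G),
      mult = (\<lambda>x y. case x of None \<Rightarrow> y
                     | Some s \<Rightarrow> (case y of None \<Rightarrow> x | Some t \<Rightarrow> Some (s \<otimes>\<^bsub>G\<^esub> t))),
      one = None\<rparr>"

definition L1 :: "nat \<Rightarrow> gen list option set option monoid" where
  "L1 l = adjoin_one (L l)"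


section \<open>Identities and isoterms\<close>

text \<open>The countably infinite alphabet of variables.\<close>

type_synonym var = nat

primrec word_value :: "('a, 'm) monoid_scheme \<Rightarrow> (var \<Rightarrow> 'a) \<Rightarrow> var list \<Rightarrow> 'a" where
  "word_value M \<phi> [] = \<one>\<^bsub>M\<^esub>"
| "word_value M \<phi> (x # w) = \<phi> x \<otimes>\<^bsub>M\<^esub> word_value M \<phi> w"

definition satisfies :: "('a, 'm) monoid_scheme \<Rightarrow> var list \<Rightarrow> var list \<Rightarrow> bool" where
  "satisfies M u v \<longleftrightarrow> (\<forall>\<phi>\<in>UNIV \<rightarrow> carrier M. word_value M \<phi> u = word_value M \<phi> v)"

definition isoterm :: "('a, 'm) monoid_scheme \<Rightarrow> var list \<Rightarrow> bool" where
  "isoterm M u \<longleftrightarrow> (\<forall>v. satisfies M u v \<longrightarrow> u = v)"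

definition Isot :: "('a, 'm) monoid_scheme \<Rightarrow> var list set" where
  "Isot M = {u. isoterm M u}"


section \<open>The monoids \<open>S\<^sup>1(W)\<close> and equational equivalence\<close>

definition word_monoid :: "var list monoid" where
  "word_monoid = \<lparr>carrier = UNIV, mult = (@), one = []\<rparr>"

definition S1 :: "var list set \<Rightarrow> var list set monoid" where
  "S1 W = quotient_monoid word_monoid
            (rees_congruence word_monoid {w. \<not> (\<exists>u\<in>W. sublist w u)})"

text \<open>
  The variety generated by \<open>S\<close>, as the class of all homomorphic images of subsemigroups of direct
  powers of \<open>S\<close>, cut down to the semigroups with elements in the type \<open>'u\<close>. The exponents are sets
  of functions \<open>'u \<Rightarrow> 's\<close> only because a type has to be named here;
  by \<open>in_generated_varietyI\<close> below, exponents from any other type give nothing new.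
\<close>

definition generated_variety :: "('s, 'm) monoid_scheme \<Rightarrow> 'u monoid set" where
  "generated_variety S =
     {T. \<exists>(I :: ('u \<Rightarrow> 's) set) H h.
           subsemigroup H (product_group I (\<lambda>_. S)) \<and>
           h \<in> hom (product_group I (\<lambda>_. S) \<lparr>carrier := H\<rparr>) T \<and>
           h ` H = carrier T}"

lemma in_generated_varietyI:
  fixes S :: "('s, 'm) monoid_scheme" and T :: "'u monoid" and J :: "'j set"
  assumes H: "subsemigroup H (product_group J (\<lambda>_. S))"
    and h: "h \<in> hom (product_group J (\<lambda>_. S) \<lparr>carrier := H\<rparr>) T"
    and surj: "h ` H = carrier T"
  shows "T \<in> generated_variety S"
proof -
  obtain g where g: "\<And>t. t \<in> carrier T \<Longrightarrow> g t \<in> H \<and> h (g t) = t"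
  proof
    show "inv_into H h t \<in> H \<and> h (inv_into H h t) = t" if "t \<in> carrier T" for t
      using that surj by (metis inv_into_into f_inv_into_f)
  qed
  obtain p0 where p0: "p0 \<in> H"
    using H by (auto simp: subsemigroup_def)
  define g' where "g' t = (if t \<in> carrier T then g t else p0)" for t
  have g'H: "g' t \<in> H" for t
    using g p0 by (auto simp: g'_def)
  have HJ: "H \<subseteq> (\<Pi>\<^sub>E j\<in>J. carrier S)"
    using H by (simp add: subsemigroup_def)
  have Hmult: "(\<lambda>j\<in>J. p j \<otimes>\<^bsub>S\<^esub> q j) \<in> H" if "p \<in> H" "q \<in> H" for p q
    using H that by (simp add: subsemigroup_def product_group_def)
  have hmult: "h (\<lambda>j\<in>J. p j \<otimes>\<^bsub>S\<^esub> q j) = h p \<otimes>\<^bsub>T\<^esub> h q" if "p \<in> H" "q \<in> H" for p q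
    using h that by (simp add: hom_def product_group_def)
  define f where "f j = (\<lambda>t. g' t j)" for j
  define I where "I = f ` J"
  define r where "r q = (\<lambda>j\<in>J. q (f j))" for q :: "('u \<Rightarrow> 's) \<Rightarrow> 's"
  define K where "K = {q \<in> (\<Pi>\<^sub>E i\<in>I. carrier S). r q \<in> H}"
  define e where "e t = (\<lambda>i\<in>I. i t)" for t :: 'u
  have re: "r (e t) = g' t" for t
  proof
    fix j
    have "g' t \<in> extensional J"
      using g'H[of t] HJ by (auto simp: PiE_def)
    then show "r (e t) j = g' t j"
      by (cases "j \<in> J") (simp_all add: r_def e_def I_def f_def extensional_def)
  qed
  have eK: "e t \<in> K" for t
  proof -
    have "g' t j \<in> carrier S" if "j \<in> J" for j
      using g'H[of t] HJ that by (auto simp: PiE_def Pi_def)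
    then have "e t \<in> (\<Pi>\<^sub>E i\<in>I. carrier S)"
      unfolding e_def I_def f_def by (intro restrict_PiE_iff[THEN iffD2]) auto
    then show ?thesis
      using g'H re by (simp add: K_def)
  qed
  have closed: "(\<lambda>j\<in>J. r p j \<otimes>\<^bsub>S\<^esub> r q j) \<in> H" if "p \<in> K" "q \<in> K" for p q
    using Hmult that by (simp add: K_def)
  have rmult: "r (\<lambda>i\<in>I. p i \<otimes>\<^bsub>S\<^esub> q i) = (\<lambda>j\<in>J. r p j \<otimes>\<^bsub>S\<^esub> r q j)" for p q
    unfolding r_def by (rule restrict_ext) (simp add: I_def)
  have sK: "(\<lambda>i\<in>I. p i \<otimes>\<^bsub>S\<^esub> q i) \<in> K" if "p \<in> K" "q \<in> K" for p q
  proof -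
    have "p (f j) \<otimes>\<^bsub>S\<^esub> q (f j) \<in> carrier S" if "j \<in> J" for j
    proof -
      have "(\<lambda>j\<in>J. r p j \<otimes>\<^bsub>S\<^esub> r q j) j \<in> carrier S"
        using closed[OF \<open>p \<in> K\<close> \<open>q \<in> K\<close>] HJ that by (blast dest: PiE_mem)
      then show ?thesis
        using that by (simp add: r_def)
    qed
    then have "(\<lambda>i\<in>I. p i \<otimes>\<^bsub>S\<^esub> q i) \<in> (\<Pi>\<^sub>E i\<in>I. carrier S)"
      unfolding I_def by (intro restrict_PiE_iff[THEN iffD2]) auto
    then show ?thesis
      using closed[OF that] by (simp add: K_def rmult)
  qed
  have rK: "r q \<in> H" if "q \<in> K" for q
    using that by (simp add: K_def)
  have "subsemigroup K (product_group I (\<lambda>_. S))"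
    using eK[of undefined] sK unfolding subsemigroup_def product_group_def
    by (auto simp: K_def)
  moreover have "(h \<circ> r) \<in> hom (product_group I (\<lambda>_. S) \<lparr>carrier := K\<rparr>) T"
  proof (rule homI)
    fix p assume "p \<in> carrier (product_group I (\<lambda>_. S) \<lparr>carrier := K\<rparr>)"
    then have "h (r p) \<in> h ` H"
      using rK by simp
    then show "(h \<circ> r) p \<in> carrier T"
      using surj by simp
  next
    fix p q
    assume "p \<in> carrier (product_group I (\<lambda>_. S) \<lparr>carrier := K\<rparr>)"
      and "q \<in> carrier (product_group I (\<lambda>_. S) \<lparr>carrier := K\<rparr>)"
    then have "p \<in> K" "q \<in> K"
      by simp_all
    then show "(h \<circ> r) (p \<otimes>\<^bsub>product_group I (\<lambda>_. S) \<lparr>carrier := K\<rparr>\<^esub> q) =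
        (h \<circ> r) p \<otimes>\<^bsub>T\<^esub> (h \<circ> r) q"
      using hmult[OF rK rK] by (simp add: product_group_def rmult)
  qed
  moreover have "(h \<circ> r) ` K = carrier T"
  proof
    have "h (r q) \<in> h ` H" if "q \<in> K" for q
      using rK[OF that] by simp
    then show "(h \<circ> r) ` K \<subseteq> carrier T"
      unfolding surj by auto
    show "carrier T \<subseteq> (h \<circ> r) ` K"
    proof
      fix t assume t: "t \<in> carrier T"
      then have "(h \<circ> r) (e t) = t"
        using g[OF t] by (simp add: re g'_def)
      then show "t \<in> (h \<circ> r) ` K"
        using eK[of t] by (metis image_eqI)
    qed
  qed
  ultimately show ?thesis
    unfolding generated_variety_def by blast
qed

text \<open>
  The type argument is the universe over which the two varieties are compared; a theorem that is
  polymorphic in \<open>'u\<close> compares them over every universe.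
\<close>

definition equationally_equivalent ::
  "'u itself \<Rightarrow> var list set \<Rightarrow> var list set \<Rightarrow> bool" where
  "equationally_equivalent (_ :: 'u itself) W W' \<longleftrightarrow>
     (generated_variety (S1 W) :: 'u monoid set) = generated_variety (S1 W')"

end

theory Submission
  imports Defs
begin

text \<open>
  Put \<open>m = l div 2\<close>. For \<open>2 \<le> l \<le> 5\<close> the isoterms of \<open>L1 l\<close> are exactly the words in which every
  variable occurs at most \<open>m\<close> times; as \<open>m\<close> is the same for \<open>l = 2, 3\<close> and for \<open>l = 4, 5\<close>, this
  gives both equalities between sets of isoterms.
  
  The nonzero elements of \<open>L l\<close> are the words over \<open>{a, b}\<close> without adjacent repetitions that do not
  contain the alternating word of length \<open>l\<close> (\<open>generated_congruence_L_relations\<close>). A value that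
  involves both generators gives zero as soon as it is used \<open>m + 1\<close> times, and all other values are
  idempotent. So a variable that occurs more than \<open>m\<close> times can be doubled without changing any value
  (\<open>isoterm_L1_count_list_le\<close>). Conversely, a word is determined by its restrictions to pairs of
  variables (\<open>word_determined_by_pair_restrictions\<close>). When every variable occurs at most \<open>m \<le> 2\<close>
  times, substituting \<open>ba\<close> for one variable, and \<open>b\<close> and \<open>a\<close> for two of them, recovers the occurrence
  counts and these restrictions (\<open>isoterm_L1I\<close>).
  
  For the equational equivalences it is enough that each set consists of isoterms for the monoid of
  the other: a set \<open>W\<close> of isoterms for a monoid \<open>M\<close> makes \<open>S1 W\<close> a quotient of the relatively free
  monoid of \<open>M\<close>, which lies in a power of \<open>M\<close> (\<open>generated_variety_S1_subset\<close>). One direction is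
  immediate, since \<open>ab\<close> contains each variable at most once, and \<open>abab\<close>, \<open>aabb\<close>, \<open>abba\<close> contain each at
  most twice. For the other direction, pairs of variables suffice again: up to renaming, every word in
  two variables with at most one occurrence of each is a subword of \<open>ab\<close>, and with at most two
  occurrences of each, a subword of \<open>abab\<close>, \<open>aabb\<close> or \<open>abba\<close> (\<open>isoterm_S1_pairs\<close>).
\<close>

section \<open>Words: adjacent repetitions and two-letter restrictions\<close>

text \<open>
  The first letters of two words with the same restrictions agree: otherwise these two letters form a
  pair whose restrictions differ already at the first position. A pair is available even for a word
  in a single variable because the alphabet is infinite. This lemma reduces every isoterm question
  below to words in two variables.
\<close>

lemma word_determined_by_pair_restrictions:
  fixes u v :: "var list"
  assumes "\<And>x y. x \<noteq> y \<Longrightarrow> filter (\<lambda>z. z = x \<or> z = y) u = filter (\<lambda>z. z = x \<or> z = y) v"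
  shows "u = v"
  using assms
proof (induction u arbitrary: v)
  case Nil
  show ?case
  proof (cases v)
    case (Cons y v')
    show ?thesis
      using Nil[of y "Suc y"] Cons by simp
  qed simp
next
  case (Cons x u)
  show ?case
  proof (cases v)
    case Nil
    then show ?thesis
      using Cons.prems[of x "Suc x"] by simp
  next
    case v: (Cons y v')
    have "x = y"
    proof (rule ccontr)
      assume "x \<noteq> y"
      then show False
        using Cons.prems[of x y] v by simp
    qed
    moreover have "u = v'"
    proof (rule Cons.IH)
      fix p q :: var assume "p \<noteq> q"
      then show "filter (\<lambda>z. z = p \<or> z = q) u = filter (\<lambda>z. z = p \<or> z = q) v'"
        using Cons.prems[of p q] v \<open>x = y\<close> by (auto split: if_splits)
    qed
    ultimately show ?thesis
      using v by simp
  qed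
qed

text \<open>
  A word without adjacent repetitions can use at most one letter of each block of equal letters.
  Vanishing in \<open>L1 l\<close> therefore depends only on the reduced form of a word.
\<close>

lemma subseq_remdups_adj_iff:
  assumes "distinct_adj s"
  shows "subseq s (remdups_adj w) \<longleftrightarrow> subseq s w"
  using assms
proof (induction w arbitrary: s rule: remdups_adj.induct)
  case (3 x y w)
  show ?case
  proof (cases "x = y")
    case True
    have "subseq s (x # x # w) \<longleftrightarrow> subseq s (x # w)"
    proof (cases s)
      case (Cons c t)
      have "t = [] \<or> hd t \<noteq> c"
        using 3(3) Cons by (auto simp: distinct_adj_Cons)
      then have "subseq t w" if "c = x" "subseq t (x # w)"
        using that by (cases t) auto
      then show ?thesis
        using Cons by auto
    qed simp
    then show ?thesis
      using 3 True by simp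
  next
    case False
    show ?thesis
    proof (cases s)
      case (Cons c t)
      have "distinct_adj t"
        using 3(3) Cons by (rule_tac distinct_adj_ConsD) simp
      then have "subseq t (remdups_adj (y # w)) \<longleftrightarrow> subseq t (y # w)"
        and "subseq s (remdups_adj (y # w)) \<longleftrightarrow> subseq s (y # w)"
        using 3 False by blast+
      then show ?thesis
        using Cons False by (cases "c = x") auto
    qed simp
  qed
qed auto

lemma remdups_adj_append_remdups_adj_right:
  "remdups_adj (u @ remdups_adj w) = remdups_adj (u @ w)"
proof (induction u)
  case Nil
  show ?case
    using distinct_adj_altdef[of "remdups_adj w"] by simp
next
  case (Cons x u)
  then show ?case
    by (simp add: remdups_adj_Cons)
qed

lemma remdups_adj_append_cong:
  assumes "remdups_adj u = remdups_adj u'" and "remdups_adj v = remdups_adj v'"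
  shows "remdups_adj (u @ v) = remdups_adj (u' @ v')"
proof -
  have left: "remdups_adj (u @ w) = remdups_adj (u' @ w)" for w
  proof -
    have "rev (remdups_adj (rev w @ remdups_adj (rev u))) =
        rev (remdups_adj (rev w @ remdups_adj (rev u')))"
      using assms(1) by simp
    then show ?thesis
      unfolding remdups_adj_append_remdups_adj_right remdups_adj_rev[symmetric] by simp
  qed
  have "remdups_adj (u @ v) = remdups_adj (u @ remdups_adj v)"
    by (simp only: remdups_adj_append_remdups_adj_right)
  also have "\<dots> = remdups_adj (u @ v')"
    unfolding assms(2) by (simp only: remdups_adj_append_remdups_adj_right)
  finally show ?thesis
    using left by simp
qed

text \<open>
  The reduced form records the order of the blocks, and the occurrence counts give their lengths: a
  letter that occurs twice forms either one block of length two or two blocks of length one, and the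
  reduced form tells which. For three occurrences this fails, as \<open>aaba\<close> and \<open>abaa\<close> show; hence the
  restriction to \<open>l \<le> 5\<close> below.
\<close>

lemma remdups_adj_determines_word:
  assumes "remdups_adj p = remdups_adj q"
    and "\<And>c. count_list p c = count_list q c" and "\<And>c. count_list p c \<le> 2"
  shows "p = q"
proof -
  have no_split: False
    if eq: "remdups_adj (c # c # p) = remdups_adj (c # q)" and q: "q = [] \<or> hd q \<noteq> c"
      and cnt: "count_list (c # c # p) c \<le> 2" "count_list (c # c # p) c = count_list (c # q) c"
    for c and p q :: "'a list"
  proof -
    have p: "c \<notin> set p"
      using cnt by (simp add: count_list_0_iff)
    have "c \<in> set q"
      using cnt by (metis count_list.simps(2) count_notin One_nat_def Suc_eq_plus1 add_Suc_right
          diff_add_inverse2 nat.distinct(1) add_is_0)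
    then have "remdups_adj (c # q) = c # remdups_adj q"
      using q by (cases q) auto
    moreover have "remdups_adj (c # c # p) = c # remdups_adj p"
      using p by (cases p) auto
    ultimately have "remdups_adj p = remdups_adj q"
      using eq by simp
    then have "set p = set q"
      by (metis remdups_adj_set)
    then show False
      using p \<open>c \<in> set q\<close> by simp
  qed
  show ?thesis
    using assms
  proof (induction p arbitrary: q)
    case Nil
    then show ?case
      by (metis remdups_adj.simps(1) remdups_adj_Nil_iff)
  next
    case (Cons c p)
    have "q \<noteq> []"
      using Cons.prems(1) by auto
    moreover have "hd q = c"
      using Cons.prems(1) by (metis hd_remdups_adj list.sel(1))
    ultimately obtain q' where q: "q = c # q'"
      by (metis list.collapse)
    have cnt: "count_list p d = count_list q' d" for d
      using Cons.prems(2)[of d] q by (simp split: if_splits)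
    have le: "count_list p d \<le> 2" for d
      using Cons.prems(3)[of d] by (simp split: if_splits)
    have "remdups_adj p = remdups_adj q'"
    proof (cases "p = [] \<or> hd p \<noteq> c")
      case p: True
      have "q' = [] \<or> hd q' \<noteq> c"
      proof (rule ccontr)
        assume "\<not> ?thesis"
        then obtain r where "q' = c # r"
          by (metis list.collapse)
        then show False
          using no_split[of c r p] p Cons.prems(1) Cons.prems(2)[of c] Cons.prems(3)[of c] q by auto
      qed
      then show ?thesis
        using p Cons.prems(1) q by (cases p; cases q') auto
    next
      case p: False
      then obtain p' where p': "p = c # p'"
        by (metis list.collapse)
      have "\<not> (q' = [] \<or> hd q' \<noteq> c)"
        using no_split[of c p' q'] Cons.prems(1) Cons.prems(2)[of c] Cons.prems(3)[of c] p' q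
        by auto
      then obtain r where "q' = c # r"
        by (metis list.collapse)
      then show ?thesis
        using Cons.prems(1) p' q by simp
    qed
    then show ?case
      using Cons.IH cnt le q by blast
  qed
qed

section \<open>Alternating words\<close>

lemma length_alternating [simp]: "length (alternating l) = l"
  by (simp add: alternating_def)

lemma distinct_adj_alternating: "distinct_adj (alternating l)"
  by (simp add: distinct_adj_conv_nth alternating_def)

lemma alternating_Suc: "alternating (Suc l) = alternating l @ [if even l then Ga else Gb]"
  by (simp add: alternating_def)

lemma hd_alternating: "0 < l \<Longrightarrow> hd (alternating l) = Ga"
  by (simp add: alternating_def hd_map)

lemma subseq_alternating_mono:
  assumes "k \<le> l"
  shows "subseq (alternating k) (alternating l)"
  using assms
proof (induction l rule: dec_induct)
  case (step l)
  then show ?case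
    by (simp add: alternating_Suc subseq_rev_drop_many)
qed simp

lemma alternating_even: "alternating (2 * m) = concat (replicate m [Ga, Gb])"
proof (induction m)
  case (Suc m)
  have "concat (replicate m w) @ w = w @ concat (replicate m w)" for w :: "gen list"
    by (induction m) auto
  from this[of "[Ga, Gb]"] show ?case
    using Suc by (simp add: alternating_Suc)
qed (simp add: alternating_def)

lemma Gb_alternating_odd: "Gb # alternating (Suc (2 * m)) = concat (replicate (Suc m) [Gb, Ga])"
proof -
  have "Gb # concat (replicate m [Ga, Gb]) @ [Ga] = concat (replicate (Suc m) [Gb, Ga])"
    by (induction m) auto
  then show ?thesis
    by (simp add: alternating_Suc alternating_even)
qed

lemma prefix_distinct_adj_gen:
  fixes s w :: "gen list"
  assumes "distinct_adj s" "distinct_adj w" "length s \<le> length w" "s \<noteq> [] \<Longrightarrow> hd s = hd w"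
  shows "prefix s w"
  using assms
proof (induction s arbitrary: w)
  case (Cons c s)
  then obtain w' where w: "w = c # w'"
    by (cases w) auto
  have "prefix s w'"
  proof (rule Cons.IH)
    show "hd s = hd w'" if "s \<noteq> []"
    proof -
      have "w' \<noteq> []"
        using that Cons.prems(3) w by auto
      then have "hd s \<noteq> c" "hd w' \<noteq> c"
        using Cons.prems w that by (auto simp: distinct_adj_Cons)
      then show ?thesis
        by (metis gen.exhaust)
    qed
  qed (use Cons.prems w in \<open>auto simp: distinct_adj_Cons\<close>)
  then show ?case
    using w by simp
qed simp

text \<open>
  Over two letters, a word without adjacent repetitions is determined by its first letter and its
  length, so scattered and contiguous occurrences of such words in each other are the same thing.
\<close>

lemma sublist_distinct_adj_gen:
  fixes s w :: "gen list"
  assumes "distinct_adj s" "distinct_adj w" "subseq s w"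
  shows "sublist s w"
proof (cases "s = [] \<or> hd s = hd w")
  case True
  then show ?thesis
    using prefix_distinct_adj_gen[OF assms(1,2)] list_emb_length[OF assms(3)] by blast
next
  case False
  then obtain c t where s: "s = c # t"
    by (cases s) auto
  then obtain d w' where w: "w = d # w'"
    using assms(3) by (cases w) auto
  have sub: "subseq s w'"
    using assms(3) False s w by auto
  then have "w' \<noteq> []"
    using s by auto
  then have "hd w' \<noteq> d"
    using assms(2) w by (auto simp: distinct_adj_Cons)
  then have "hd s = hd w'"
    using False w by (metis gen.exhaust list.sel(1))
  then have "prefix s w'"
    using prefix_distinct_adj_gen[of s w'] list_emb_length[OF sub] assms w
    by (auto dest: distinct_adj_ConsD)
  then have "sublist s w'"
    by blast
  then show ?thesis
    using w by (simp add: sublist_Cons_right)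
qed

section \<open>Quotients and congruences\<close>

lemma quotient_monoid_mult:
  assumes "congruence G \<theta>" and x: "x \<in> carrier G" and y: "y \<in> carrier G"
  shows "\<theta> `` {x} \<otimes>\<^bsub>quotient_monoid G \<theta>\<^esub> \<theta> `` {y} = \<theta> `` {x \<otimes>\<^bsub>G\<^esub> y}"
proof -
  have eq: "equiv (carrier G) \<theta>"
    and mult: "\<And>x y z. (x, y) \<in> \<theta> \<Longrightarrow> z \<in> carrier G \<Longrightarrow>
      (x \<otimes>\<^bsub>G\<^esub> z, y \<otimes>\<^bsub>G\<^esub> z) \<in> \<theta> \<and> (z \<otimes>\<^bsub>G\<^esub> x, z \<otimes>\<^bsub>G\<^esub> y) \<in> \<theta>"
    using assms(1) unfolding congruence_def by auto
  have "\<theta> `` {x' \<otimes>\<^bsub>G\<^esub> y'} = \<theta> `` {x \<otimes>\<^bsub>G\<^esub> y}" if "(x, x') \<in> \<theta>" "(y, y') \<in> \<theta>" for x' y'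
  proof -
    have "x' \<in> carrier G"
      using eq that(1) by (meson equiv_class_eq_iff)
    then have "(x' \<otimes>\<^bsub>G\<^esub> y, x' \<otimes>\<^bsub>G\<^esub> y') \<in> \<theta>" "(x \<otimes>\<^bsub>G\<^esub> y, x' \<otimes>\<^bsub>G\<^esub> y) \<in> \<theta>"
      using mult that y by blast+
    then show ?thesis
      using eq by (metis equiv_class_eq_iff)
  qed
  then have const: "\<theta> `` {x' \<otimes>\<^bsub>G\<^esub> y'} = \<theta> `` {x \<otimes>\<^bsub>G\<^esub> y}"
    if "x' \<in> \<theta> `` {x}" "y' \<in> \<theta> `` {y}" for x' y'
    using that by simp
  have "x \<in> \<theta> `` {x}" "y \<in> \<theta> `` {y}"
    by (rule equiv_class_self[OF eq x], rule equiv_class_self[OF eq y])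
  then have "(\<Union>x'\<in>\<theta> `` {x}. \<Union>y'\<in>\<theta> `` {y}. \<theta> `` {x' \<otimes>\<^bsub>G\<^esub> y'}) = \<theta> `` {x \<otimes>\<^bsub>G\<^esub> y}"
    using const by blast
  then show ?thesis
    by (simp add: quotient_monoid_def)
qed

lemma word_value_hom:
  assumes "\<And>x y. h (x \<otimes>\<^bsub>N\<^esub> y) = h x \<otimes>\<^bsub>M\<^esub> h y" and "h \<one>\<^bsub>N\<^esub> = \<one>\<^bsub>M\<^esub>"
  shows "word_value M (h \<circ> \<sigma>) w = h (word_value N \<sigma> w)"
  using assms by (induction w) auto

text \<open>
  If \<open>M\<close> is a homomorphic image of \<open>N\<close>, identities of \<open>M\<close> can be tested by evaluating in \<open>N\<close> and
  projecting. With \<open>N\<close> a free monoid, with or without a zero, evaluation is substitution of words.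
\<close>

lemma satisfies_image:
  assumes "\<And>x y. h (x \<otimes>\<^bsub>N\<^esub> y) = h x \<otimes>\<^bsub>M\<^esub> h y" and "h \<one>\<^bsub>N\<^esub> = \<one>\<^bsub>M\<^esub>"
    and carrier: "carrier M = range h"
  shows "satisfies M u v \<longleftrightarrow> (\<forall>\<sigma>. h (word_value N \<sigma> u) = h (word_value N \<sigma> v))"
proof
  assume sat: "satisfies M u v"
  show "\<forall>\<sigma>. h (word_value N \<sigma> u) = h (word_value N \<sigma> v)"
  proof
    fix \<sigma> :: "var \<Rightarrow> _"
    have "h \<circ> \<sigma> \<in> UNIV \<rightarrow> carrier M"
      using carrier by auto
    then show "h (word_value N \<sigma> u) = h (word_value N \<sigma> v)"
      using sat unfolding satisfies_def word_value_hom[OF assms(1,2), symmetric] by blast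
  qed
next
  assume R: "\<forall>\<sigma>. h (word_value N \<sigma> u) = h (word_value N \<sigma> v)"
  show "satisfies M u v"
    unfolding satisfies_def
  proof
    fix \<phi> :: "var \<Rightarrow> _" assume "\<phi> \<in> UNIV \<rightarrow> carrier M"
    then have "\<forall>x. \<exists>y. \<phi> x = h y"
      using carrier by (auto simp: Pi_def)
    then obtain \<sigma> where "\<And>x. \<phi> x = h (\<sigma> x)"
      by metis
    then have "\<phi> = h \<circ> \<sigma>"
      by auto
    then show "word_value M \<phi> u = word_value M \<phi> v"
      using R by (simp add: word_value_hom[OF assms(1,2)])
  qed
qed

section \<open>The word problem of \<open>L1\<close>\<close>

text \<open>
  The free monoid with zero. It differs from \<open>free_semigroup0\<close> only in containing the empty word,
  which stands for the identity that \<open>adjoin_one\<close> adds.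
\<close>

definition words0 :: "'x list option monoid" where
  "words0 = free_semigroup0\<lparr>carrier := UNIV, one := Some []\<rparr>"

lemma words0_simps [simp]:
  "None \<otimes>\<^bsub>words0\<^esub> y = None" "x \<otimes>\<^bsub>words0\<^esub> None = None"
  "Some u \<otimes>\<^bsub>words0\<^esub> Some v = Some (u @ v)" "\<one>\<^bsub>words0\<^esub> = Some []"
  by (simp_all add: words0_def free_semigroup0_def split: option.split)

lemma free_semigroup0_simps [simp]:
  "x \<otimes>\<^bsub>free_semigroup0\<^esub> y = x \<otimes>\<^bsub>words0\<^esub> y"
  "carrier free_semigroup0 = insert None (Some ` {w. w \<noteq> []})"
  by (simp_all add: words0_def free_semigroup0_def)

text \<open>
  Idempotence of the generators deletes adjacent repetitions, after which the word is zero if and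
  only if it contains the alternating word. The test is stated for scattered subwords of the
  unreduced word, which amounts to the same and is visibly stable under multiplication.
\<close>

fun normal_form :: "nat \<Rightarrow> gen list option \<Rightarrow> gen list option" where
  "normal_form l None = None"
| "normal_form l (Some w) = (if subseq (alternating l) w then None else Some (remdups_adj w))"

definition same_normal_form :: "nat \<Rightarrow> (gen list option \<times> gen list option) set" where
  "same_normal_form l = {(x, y). x \<in> carrier free_semigroup0 \<and> y \<in> carrier free_semigroup0 \<and>
     normal_form l x = normal_form l y}"

lemma normal_form_eqI:
  assumes "remdups_adj u = remdups_adj v"
  shows "normal_form l (Some u) = normal_form l (Some v)"
  using assms subseq_remdups_adj_iff[OF distinct_adj_alternating, of l u]
    subseq_remdups_adj_iff[OF distinct_adj_alternating, of l v]
  by simp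

lemma normal_form_mult:
  assumes "normal_form l x = normal_form l x'" and "normal_form l y = normal_form l y'"
  shows "normal_form l (x \<otimes>\<^bsub>words0\<^esub> y) = normal_form l (x' \<otimes>\<^bsub>words0\<^esub> y')"
proof -
  have zero: "normal_form l (x \<otimes>\<^bsub>words0\<^esub> y) = None" if "normal_form l x = None \<or> normal_form l y = None"
    for x y
    using that
    by (cases x; cases y) (auto simp: subseq_rev_drop_many subseq_drop_many split: if_splits)
  show ?thesis
  proof (cases "normal_form l x = None \<or> normal_form l y = None")
    case True
    then show ?thesis
      using zero assms by metis
  next
    case False
    then obtain u u' v v' where "x = Some u" "x' = Some u'" "y = Some v" "y' = Some v'"
      using assms by (metis normal_form.simps(1) option.exhaust)
    moreover from this have "remdups_adj u = remdups_adj u'" "remdups_adj v = remdups_adj v'"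
      using False assms by (auto split: if_splits)
    ultimately show ?thesis
      using normal_form_eqI[OF remdups_adj_append_cong, of u u' v v' l]
      by (simp del: normal_form.simps)
  qed
qed

lemma congruence_same_normal_form: "congruence free_semigroup0 (same_normal_form l)"
proof -
  have "equiv (carrier free_semigroup0) (same_normal_form l)"
    unfolding same_normal_form_def
    by (intro equivI refl_onI symI transI) (auto simp del: free_semigroup0_simps)
  moreover have "x \<otimes>\<^bsub>words0\<^esub> y \<in> carrier free_semigroup0"
    if "x \<in> carrier free_semigroup0" "y \<in> carrier free_semigroup0"
    for x y :: "gen list option"
    using that by auto
  ultimately show ?thesis
    unfolding congruence_def free_semigroup0_simps(1)
    by (auto simp del: free_semigroup0_simps(2) simp: same_normal_form_def intro: normal_form_mult)
qed

lemma congruence_context: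
  assumes "congruence free_semigroup0 \<theta>" and "(x, y) \<in> \<theta>"
  shows "(Some p \<otimes>\<^bsub>words0\<^esub> x, Some p \<otimes>\<^bsub>words0\<^esub> y) \<in> \<theta>"
    and "(x \<otimes>\<^bsub>words0\<^esub> Some p, y \<otimes>\<^bsub>words0\<^esub> Some p) \<in> \<theta>"
proof -
  have unit: "Some [] \<otimes>\<^bsub>words0\<^esub> z = z" "z \<otimes>\<^bsub>words0\<^esub> Some [] = z" for z :: "'a list option"
    by (cases z; simp)+
  have "Some p \<in> carrier free_semigroup0" if "p \<noteq> []"
    using that by simp
  then show "(Some p \<otimes>\<^bsub>words0\<^esub> x, Some p \<otimes>\<^bsub>words0\<^esub> y) \<in> \<theta>"
    and "(x \<otimes>\<^bsub>words0\<^esub> Some p, y \<otimes>\<^bsub>words0\<^esub> Some p) \<in> \<theta>"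
    using assms unit unfolding congruence_def free_semigroup0_simps(1)
    by (cases "p = []"; fastforce simp del: free_semigroup0_simps(2))+
qed

text \<open>
  This solves the word problem of \<open>L l\<close>. The kernel of the normal form is a congruence that contains
  the relations; conversely, the relations rewrite every word to its normal form, because a reduced
  word with the alternating word as a scattered subword contains it contiguously.
\<close>

lemma generated_congruence_L_relations:
  assumes "0 < l"
  shows "generated_congruence free_semigroup0 (L_relations l) = same_normal_form l"
proof
  have "alternating l \<noteq> []"
    using assms by (metis length_alternating length_0_conv less_irrefl)
  moreover have "remdups_adj [c, c] = remdups_adj [c]" for c :: gen
    by simp
  ultimately have "L_relations l \<subseteq> same_normal_form l"
    using normal_form_eqI[of "[Ga, Ga]" "[Ga]" l] normal_form_eqI[of "[Gb, Gb]" "[Gb]" l]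
    unfolding L_relations_def same_normal_form_def
    by (auto simp del: normal_form.simps(2)) simp
  then show "generated_congruence free_semigroup0 (L_relations l) \<subseteq> same_normal_form l"
    unfolding generated_congruence_def using congruence_same_normal_form by blast
  have "same_normal_form l \<subseteq> \<theta>" if cong: "congruence free_semigroup0 \<theta>" and R: "L_relations l \<subseteq> \<theta>" for \<theta>
  proof -
    have eq: "equiv (carrier free_semigroup0) \<theta>"
      using cong by (simp add: congruence_def)
    have refl: "(x, x) \<in> \<theta>" if "x \<in> carrier free_semigroup0" for x
      using eq that by (auto elim: equivE dest: refl_onD)
    have sym: "(y, x) \<in> \<theta>" if "(x, y) \<in> \<theta>" for x y
      using eq that by (auto elim: equivE dest: symD)
    have trans: "(x, z) \<in> \<theta>" if "(x, y) \<in> \<theta>" "(y, z) \<in> \<theta>" for x y z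
      using eq that by (auto elim: equivE dest: transD)
    have idem: "(Some [c, c], Some [c]) \<in> \<theta>" for c
      using R by (cases c) (auto simp: L_relations_def)
    have reduce: "(Some w, Some (remdups_adj w)) \<in> \<theta>" if "w \<noteq> []" for w
      using that
    proof (induction w rule: remdups_adj.induct)
      case (2 x)
      then show ?case
        by (simp add: refl)
    next
      case (3 x y w)
      show ?case
      proof (cases "x = y")
        case True
        have "(Some (x # x # w), Some (x # w)) \<in> \<theta>"
          using congruence_context(2)[OF cong idem[of x], of w] by simp
        then show ?thesis
          using 3 True trans by simp
      next
        case False
        then show ?thesis
          using 3 congruence_context(1)[OF cong, of "Some (y # w)" "Some (remdups_adj (y # w))" "[x]"]
          by simp
      qed
    qed simp
    have zero: "(Some w, None) \<in> \<theta>" if "subseq (alternating l) w" for w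
    proof -
      have "subseq (alternating l) (remdups_adj w)"
        using that subseq_remdups_adj_iff[OF distinct_adj_alternating] by blast
      then have "sublist (alternating l) (remdups_adj w)"
        by (intro sublist_distinct_adj_gen distinct_adj_alternating distinct_adj_remdups_adj)
      then obtain p s where "remdups_adj w = p @ alternating l @ s"
        by (auto simp: sublist_def)
      moreover have "(Some (alternating l), None) \<in> \<theta>"
        using R by (auto simp: L_relations_def)
      ultimately have "(Some (remdups_adj w), None) \<in> \<theta>"
        using congruence_context(1)[OF cong congruence_context(2)[OF cong, of _ None s],
            of "Some (alternating l)" p]
        by simp
      moreover have "w \<noteq> []"
        using that \<open>alternating l \<noteq> []\<close> by auto
      ultimately show ?thesis
        using reduce trans by blast
    qed
    have nf: "(x, normal_form l x) \<in> \<theta>" if "x \<in> carrier free_semigroup0" for x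
      using that zero reduce refl by auto
    show ?thesis
      using nf sym trans unfolding same_normal_form_def by (smt (verit) mem_Collect_eq case_prodE subsetI)
  qed
  then show "same_normal_form l \<subseteq> generated_congruence free_semigroup0 (L_relations l)"
    unfolding generated_congruence_def by blast
qed

lemma satisfies_L1_iff:
  assumes "0 < l"
  shows "satisfies (L1 l) u v \<longleftrightarrow>
    (\<forall>\<sigma>. normal_form l (word_value words0 \<sigma> u) = normal_form l (word_value words0 \<sigma> v))"
proof -
  define cls where "cls x = same_normal_form l `` {x}" for x
  define h where "h x = (if x = Some [] then None else Some (cls x))" for x
  have L: "L l = quotient_monoid free_semigroup0 (same_normal_form l)"
    using assms by (simp add: L_def generated_congruence_L_relations)
  have mult: "cls x \<otimes>\<^bsub>L l\<^esub> cls y = cls (x \<otimes>\<^bsub>words0\<^esub> y)" if "x \<noteq> Some []" "y \<noteq> Some []" for x y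
    using quotient_monoid_mult[OF congruence_same_normal_form, of x y l] that
    by (cases x; cases y) (auto simp: L cls_def)
  have h_mult: "h (x \<otimes>\<^bsub>words0\<^esub> y) = h x \<otimes>\<^bsub>L1 l\<^esub> h y" for x y
  proof (cases "x = Some [] \<or> y = Some []")
    case True
    then show ?thesis
      by (cases x; cases y) (auto simp: h_def L1_def adjoin_one_def)
  next
    case False
    then have "x \<otimes>\<^bsub>words0\<^esub> y \<noteq> Some []"
      by (cases x; cases y) auto
    then show ?thesis
      using False mult by (simp add: h_def L1_def adjoin_one_def)
  qed
  have h_one: "h \<one>\<^bsub>words0\<^esub> = \<one>\<^bsub>L1 l\<^esub>"
    by (simp add: h_def L1_def adjoin_one_def)
  have range: "carrier (L1 l) = range h"
  proof -
    have "carrier (L l) = cls ` {x. x \<noteq> Some []}"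
    proof -
      have "carrier free_semigroup0 = {x :: gen list option. x \<noteq> Some []}"
        by (auto simp: image_iff) (metis option.exhaust)
      then show ?thesis
        by (auto simp: L quotient_monoid_def quotient_def cls_def)
    qed
    then show ?thesis
      by (auto simp: L1_def adjoin_one_def h_def image_iff)
  qed
  have h_eq: "h x = h y \<longleftrightarrow> normal_form l x = normal_form l y" for x y
  proof -
    have "alternating l \<noteq> []"
      using assms by (metis length_alternating length_0_conv less_irrefl)
    then have one: "normal_form l z = normal_form l (Some []) \<longleftrightarrow> z = Some []" for z
      by (cases z) auto
    have "cls x = cls y \<longleftrightarrow> normal_form l x = normal_form l y"
      if "x \<noteq> Some []" "y \<noteq> Some []"
    proof -
      have "x \<in> carrier free_semigroup0" "y \<in> carrier free_semigroup0"
        using that by (cases x; cases y; auto)+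
      moreover have "equiv (carrier free_semigroup0) (same_normal_form l)"
        using congruence_same_normal_form by (simp add: congruence_def)
      ultimately show ?thesis
        unfolding cls_def
        by (subst eq_equiv_class_iff[of "carrier free_semigroup0"])
          (simp_all add: same_normal_form_def del: free_semigroup0_simps)
    qed
    then show ?thesis
      using one[of x] one[of y]
      by (cases "x = Some []"; cases "y = Some []") (simp_all add: h_def eq_commute)
  qed
  show ?thesis
    unfolding satisfies_image[OF h_mult h_one range] h_eq ..
qed

lemma word_value_words0:
  "word_value words0 \<sigma> w =
    (if \<exists>x\<in>set w. \<sigma> x = None then None else Some (concat (map (the \<circ> \<sigma>) w)))"
  by (induction w) (auto simp: comp_def)

lemma satisfies_L1_substitution:
  assumes "0 < l" and "satisfies (L1 l) u v"
  shows "normal_form l (Some (concat (map \<sigma> u))) = normal_form l (Some (concat (map \<sigma> v)))"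
  using assms(2) unfolding satisfies_L1_iff[OF assms(1)]
  by (elim allE[of _ "Some \<circ> \<sigma>"]) (simp add: word_value_words0 comp_def)

section \<open>Isoterms for \<open>L1\<close>\<close>

lemma subseq_concat_map:
  "subseq u v \<Longrightarrow> subseq (concat (map f u)) (concat (map f v))"
  by (induction rule: list_emb.induct) (auto simp: subseq_drop_many intro: list_emb_append_mono)

lemma subseq_replicate_count_list: "subseq (replicate (count_list w x) x) w"
  by (induction w) auto

lemma subseq_concat_replicate:
  "subseq s t \<Longrightarrow> subseq (concat (replicate n s)) (concat (replicate n t))"
  by (induction n) (auto intro: list_emb_append_mono)

text \<open>
  A word that contains both generators has \<open>ab\<close> or \<open>ba\<close> as a scattered subword, and the powers of
  \<open>ab\<close> and of \<open>ba\<close> with exponent \<open>m + 1\<close> both contain the alternating word of length \<open>2 * m + 1\<close>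
  that starts with \<open>a\<close>.
\<close>

lemma normal_form_mixed_power:
  assumes "Ga \<in> set s" "Gb \<in> set s" and "l \<le> Suc (2 * m)"
    and "subseq (concat (replicate (Suc m) s)) w"
  shows "normal_form l (Some w) = None"
proof -
  have "subseq [Ga, Gb] s \<or> subseq [Gb, Ga] s"
    using assms(1,2)
  proof (induction s)
    case (Cons c s)
    then show ?case
      by (cases c) (auto simp: subseq_singleton_left)
  qed simp
  then have "subseq (concat (replicate (Suc m) [Ga, Gb])) w \<or> subseq (concat (replicate (Suc m) [Gb, Ga])) w"
    using subseq_concat_replicate assms(4) subseq_order.trans by blast
  then have "subseq (alternating (2 * Suc m)) w \<or> subseq (Gb # alternating (Suc (2 * m))) w"
    by (simp only: alternating_even Gb_alternating_odd)
  then have "subseq (alternating (Suc (2 * m))) w"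
  proof
    assume "subseq (alternating (2 * Suc m)) w"
    then show ?thesis
      using subseq_order.trans[OF subseq_alternating_mono[of "Suc (2 * m)" "2 * Suc m"]] by simp
  qed (rule subseq_Cons')
  then have "subseq (alternating l) w"
    using subseq_alternating_mono[OF assms(3)] subseq_order.trans by blast
  then show ?thesis
    by simp
qed

text \<open>
  Suppose that \<open>x\<close> occurs more than \<open>l div 2\<close> times. Doubling one occurrence of \<open>x\<close> then gives an
  identity of \<open>L1 l\<close>: a value of \<open>x\<close> in which only one generator is involved is idempotent, and every
  other value already makes both sides zero.
\<close>

lemma isoterm_L1_count_list_le:
  assumes "0 < l" and "isoterm (L1 l) u"
  shows "count_list u x \<le> l div 2"
proof (rule ccontr)
  assume "\<not> ?thesis"
  then have many: "Suc (l div 2) \<le> count_list u x"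
    by simp
  then have "x \<in> set u"
    by (metis count_notin not_less_eq_eq le0)
  then obtain p q where u: "u = p @ x # q"
    by (meson split_list)
  define v where "v = p @ x # x # q"
  have "normal_form l (word_value words0 \<sigma> u) = normal_form l (word_value words0 \<sigma> v)" for \<sigma>
  proof (cases "\<exists>y\<in>set u. \<sigma> y = None")
    case True
    then show ?thesis
      by (auto simp: word_value_words0 u v_def)
  next
    case False
    define f where "f = the \<circ> \<sigma>"
    have vals: "word_value words0 \<sigma> u = Some (concat (map f u))"
      "word_value words0 \<sigma> v = Some (concat (map f v))"
      using False by (auto simp: word_value_words0 u v_def f_def)
    show ?thesis
    proof (cases "Ga \<in> set (f x) \<and> Gb \<in> set (f x)")
      case True
      obtain k where "count_list u x = Suc (l div 2) + k"
        using many le_Suc_ex by blast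
      then have "subseq (replicate (Suc (l div 2)) x) (replicate (count_list u x) x)"
        by (simp add: replicate_add subseq_rev_drop_many)
      then have "subseq (replicate (Suc (l div 2)) x) u"
        by (rule subseq_order.trans[OF _ subseq_replicate_count_list])
      moreover from this have "subseq (replicate (Suc (l div 2)) x) v"
        by (rule subseq_order.trans) (simp add: u v_def subseq_append' list_emb_Cons)
      ultimately have "subseq (concat (replicate (Suc (l div 2)) (f x))) (concat (map f u))"
        and "subseq (concat (replicate (Suc (l div 2)) (f x))) (concat (map f v))"
        by (auto dest!: subseq_concat_map[of _ _ f] simp only: map_replicate)
      then show ?thesis
        using normal_form_mixed_power[of "f x" l "l div 2"] True unfolding vals by auto
    next
      case mixed: False
      have "remdups_adj (f x) = remdups_adj (f x @ f x)"
      proof -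
        obtain c where "\<forall>d\<in>set (f x). d = c"
          using mixed by (metis gen.exhaust)
        then have "f x = replicate (length (f x)) c"
          by (simp add: replicate_length_same)
        then show ?thesis
          by (metis replicate_add remdups_adj_replicate add_is_0)
      qed
      from remdups_adj_append_cong[OF refl remdups_adj_append_cong[OF this refl]]
      have "remdups_adj (concat (map f u)) = remdups_adj (concat (map f v))"
        by (simp add: u v_def)
      then show ?thesis
        unfolding vals by (rule normal_form_eqI)
    qed
  qed
  then have "satisfies (L1 l) u v"
    using assms(1) by (simp add: satisfies_L1_iff)
  then have "u = v"
    using assms(2) by (simp add: isoterm_def)
  then show False
    by (simp add: u v_def)
qed

text \<open>
  Two substitutions suffice. Sending \<open>x\<close> to \<open>ba\<close> and all other variables to the identity reveals
  the number of occurrences of \<open>x\<close>, since the powers of \<open>ba\<close> with exponent at most \<open>l div 2\<close> are nonzero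
  and distinct. Sending \<open>x\<close> to \<open>b\<close> and \<open>y\<close> to \<open>a\<close> then reveals the restriction to \<open>x\<close> and \<open>y\<close>: if
  the value is nonzero, the reduced form and the counts determine the word, and if it is zero, the
  length of at most \<open>l\<close> leaves only the alternating word itself.
\<close>

lemma isoterm_L1I:
  assumes "2 \<le> l" "l \<le> 5" and le: "\<And>x. count_list u x \<le> l div 2"
  shows "isoterm (L1 l) u"
  unfolding isoterm_def
proof (intro allI impI)
  fix v assume sat: "satisfies (L1 l) u v"
  have l: "0 < l" "l div 2 \<le> 2"
    using assms by auto
  obtain t where alt: "alternating l = Ga # t"
    using hd_alternating[OF l(1)] length_alternating[of l] l(1) by (cases "alternating l") auto
  have cnt: "count_list u x = count_list v x" for x
  proof -
    \<comment> \<open>The order matters: for even \<open>l\<close> the power of \<open>ab\<close> with exponent \<open>l div 2\<close> is zero.\<close>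
    define f where "f y = (if y = x then [Gb, Ga] else [])" for y
    have val: "concat (map f w) = concat (replicate (count_list w x) [Gb, Ga])" for w
      by (induction w) (auto simp: f_def)
    have reduced: "distinct_adj (concat (replicate k [Gb, Ga]))" for k
    proof (cases k)
      case (Suc j)
      then show ?thesis
        using distinct_adj_alternating[of "Suc (2 * j)"] hd_alternating[of "Suc (2 * j)"]
        by (simp only: Gb_alternating_odd[symmetric]) (simp add: distinct_adj_Cons)
    qed simp
    have len: "length (concat (replicate k [Gb, Ga])) = 2 * k" for k
      by (induction k) auto
    have "\<not> subseq (alternating l) (concat (replicate (count_list u x) [Gb, Ga]))"
    proof
      assume sub: "subseq (alternating l) (concat (replicate (count_list u x) [Gb, Ga]))"
      then obtain k where k: "count_list u x = Suc k"
        by (cases "count_list u x") (auto simp: alt)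
      then have "subseq (Ga # t) (Ga # concat (replicate k [Gb, Ga]))"
        using sub alt by auto
      then have "length (Ga # t) \<le> length (Ga # concat (replicate k [Gb, Ga]))"
        by (rule list_emb_length)
      then have "l \<le> Suc (2 * k)"
        by (simp only: alt[symmetric]) (simp only: length_alternating length_Cons len)
      then show False
        using le[of x] k by linarith
    qed
    then have "remdups_adj (concat (replicate (count_list u x) [Gb, Ga]))
        = remdups_adj (concat (replicate (count_list v x) [Gb, Ga]))"
      using satisfies_L1_substitution[OF l(1) sat, of f] unfolding val by (simp split: if_splits)
    then have "concat (replicate (count_list u x) [Gb, Ga]) = concat (replicate (count_list v x) [Gb, Ga])"
      using reduced by (simp add: distinct_adj_altdef)
    then show ?thesis
      by (metis len mult_left_cancel zero_neq_numeral)
  qed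
  show "u = v"
  proof (rule word_determined_by_pair_restrictions)
    fix x y :: var assume "x \<noteq> y"
    define f where "f z = (if z = x then [Gb] else if z = y then [Ga] else [])" for z
    define g where "g z = (if z = x then Gb else Ga)" for z
    have val: "concat (map f w) = map g (filter (\<lambda>z. z = x \<or> z = y) w)" for w
      by (induction w) (auto simp: f_def g_def)
    have counts: "count_list (concat (map f w)) c = count_list w (if c = Gb then x else y)" for w c
      using \<open>x \<noteq> y\<close> by (induction w) (cases c; auto simp: f_def)+
    have eq: "concat (map f u) = concat (map f v)"
    proof (cases "subseq (alternating l) (concat (map f u))")
      case True
      have len: "length (concat (map f w)) = count_list w x + count_list w y" for w
        using \<open>x \<noteq> y\<close> by (induction w) (auto simp: f_def)
      have "length (concat (map f u)) \<le> l" "length (concat (map f v)) \<le> l"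
        using le[of x] le[of y] cnt[of x] cnt[of y] unfolding len by linarith+
      moreover have "subseq (alternating l) (concat (map f v))"
        using True satisfies_L1_substitution[OF l(1) sat, of f] by (simp split: if_splits)
      moreover have "alternating l = w" if "subseq (alternating l) w" "length w \<le> l" for w
        using that list_emb_length[OF that(1)] by (intro subseq_same_length) auto
      ultimately show ?thesis
        using True by metis
    next
      case False
      then have "remdups_adj (concat (map f u)) = remdups_adj (concat (map f v))"
        using satisfies_L1_substitution[OF l(1) sat, of f] by (simp split: if_splits)
      then show ?thesis
      proof (rule remdups_adj_determines_word)
        fix c
        show "count_list (concat (map f u)) c = count_list (concat (map f v)) c"
          unfolding counts by (rule cnt)
        show "count_list (concat (map f u)) c \<le> 2"
          unfolding counts using le l(2) by (meson le_trans)
      qed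
    qed
    have "inj_on g (set (filter (\<lambda>z. z = x \<or> z = y) u) \<union> set (filter (\<lambda>z. z = x \<or> z = y) v))"
      using \<open>x \<noteq> y\<close> by (auto simp: g_def inj_on_def)
    then show "filter (\<lambda>z. z = x \<or> z = y) u = filter (\<lambda>z. z = x \<or> z = y) v"
      using eq unfolding val by (simp only: inj_on_map_eq_map)
  qed
qed

lemma Isot_L1:
  assumes "2 \<le> l" "l \<le> 5"
  shows "Isot (L1 l) = {u. \<forall>x. count_list u x \<le> l div 2}"
  using assms isoterm_L1_count_list_le[of l] isoterm_L1I[of l] by (auto simp: Isot_def)

section \<open>The monoids \<open>S1\<close>\<close>

text \<open>
  The class of a word in \<open>S1 W\<close>. All words that are not subwords of words in \<open>W\<close> share one class,
  the zero.
\<close>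

definition word_class :: "var list set \<Rightarrow> var list \<Rightarrow> var list set" where
  "word_class W w =
     rees_congruence word_monoid {w. \<not> (\<exists>u\<in>W. sublist w u)} `` {w}"

lemma congruence_rees_word_monoid:
  "congruence word_monoid (rees_congruence word_monoid {w. \<not> (\<exists>u\<in>W. sublist w u)})"
proof -
  have "(\<exists>u\<in>W. sublist x u)" if "\<exists>u\<in>W. sublist (x @ z) u \<or> sublist (z @ x) u" for x z
    using that by (meson sublist_appendI sublist_append_leftI sublist_append_rightI
        sublist_order.order_trans)
  then show ?thesis
    unfolding congruence_def rees_congruence_def
    by (intro conjI equivI refl_onI symI transI) (auto simp: word_monoid_def)
qed

lemma carrier_S1: "carrier (S1 W) = range (word_class W)"
  by (auto simp: S1_def quotient_monoid_def quotient_def word_class_def word_monoid_def)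

lemma one_S1: "\<one>\<^bsub>S1 W\<^esub> = word_class W []"
  by (simp add: S1_def quotient_monoid_def word_class_def word_monoid_def)

lemma mult_S1: "word_class W u \<otimes>\<^bsub>S1 W\<^esub> word_class W v = word_class W (u @ v)"
  using quotient_monoid_mult[OF congruence_rees_word_monoid, of u v W]
  by (simp add: S1_def word_class_def word_monoid_def)

lemma word_class_eqD:
  assumes "word_class W u = word_class W v" and "\<exists>w\<in>W. sublist u w"
  shows "u = v"
  using assms by (auto simp: word_class_def rees_congruence_def word_monoid_def)

lemma word_class_eq_iff:
  "word_class W u = word_class W v \<longleftrightarrow>
    u = v \<or> \<not> (\<exists>w\<in>W. sublist u w) \<and> \<not> (\<exists>w\<in>W. sublist v w)"
  by (auto simp: word_class_def rees_congruence_def word_monoid_def)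

lemma monoid_S1: "monoid (S1 W)"
  by (rule monoidI) (auto simp: carrier_S1 one_S1 mult_S1)

lemma satisfies_S1_iff:
  "satisfies (S1 W) u v \<longleftrightarrow>
    (\<forall>\<sigma>. word_class W (concat (map \<sigma> u)) = word_class W (concat (map \<sigma> v)))"
proof -
  have "word_value word_monoid \<sigma> w = concat (map \<sigma> w)" for \<sigma> w
    by (induction w) (simp_all add: word_monoid_def)
  then show ?thesis
    using satisfies_image[of "word_class W" word_monoid "S1 W" u v]
    by (simp add: mult_S1 one_S1 carrier_S1 word_monoid_def)
qed

lemma isoterm_S1_self:
  assumes "w \<in> W"
  shows "isoterm (S1 W) w"
  unfolding isoterm_def
proof (intro allI impI)
  fix v assume "satisfies (S1 W) w v"
  then have "word_class W (concat (map (\<lambda>x. [x]) w)) = word_class W (concat (map (\<lambda>x. [x]) v))"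
    by (simp only: satisfies_S1_iff)
  then show "w = v"
    using word_class_eqD[of W w v] assms by auto
qed

text \<open>
  Substituting the letters \<open>a\<close> and \<open>b\<close> for two variables turns the restriction of \<open>u\<close> to them into a
  word over \<open>{a, b}\<close>; if that is a subword of \<open>W\<close>, the restriction is recovered from its value. As
  the two variables may be exchanged, only words that start with \<open>a\<close> need to be subwords of \<open>W\<close>.
\<close>

lemma isoterm_S1_pairs:
  fixes a b :: var
  assumes "a \<noteq> b"
    and sub: "\<And>p. set p \<subseteq> {a, b} \<Longrightarrow> (p \<noteq> [] \<Longrightarrow> hd p = a) \<Longrightarrow> count_list p a \<le> m \<Longrightarrow>
      count_list p b \<le> m \<Longrightarrow> \<exists>w\<in>W. sublist p w"
    and le: "\<And>x. count_list u x \<le> m"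
  shows "isoterm (S1 W) u"
  unfolding isoterm_def
proof (intro allI impI)
  fix v assume sat: "satisfies (S1 W) u v"
  have restrict: "filter (\<lambda>z. z = x \<or> z = y) u = filter (\<lambda>z. z = x \<or> z = y) v"
    if "x \<noteq> y" and first: "filter (\<lambda>z. z = x \<or> z = y) u \<noteq> [] \<Longrightarrow>
      hd (filter (\<lambda>z. z = x \<or> z = y) u) = x" for x y
  proof -
    define f where "f z = (if z = x then [a] else if z = y then [b] else [])" for z
    define g where "g z = (if z = x then a else b)" for z
    have val: "concat (map f w) = map g (filter (\<lambda>z. z = x \<or> z = y) w)" for w
      by (induction w) (auto simp: f_def g_def)
    have "count_list (concat (map f w)) a = count_list w x"
      "count_list (concat (map f w)) b = count_list w y" for w
      using \<open>a \<noteq> b\<close> \<open>x \<noteq> y\<close> by (induction w) (auto simp: f_def)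
    then have "\<exists>w\<in>W. sublist (concat (map f u)) w"
      using le by (intro sub) (use first in \<open>auto simp: val g_def hd_map\<close>)
    moreover have "word_class W (concat (map f u)) = word_class W (concat (map f v))"
      using sat by (simp add: satisfies_S1_iff)
    ultimately have "concat (map f u) = concat (map f v)"
      using word_class_eqD by blast
    moreover have "inj_on g (set (filter (\<lambda>z. z = x \<or> z = y) u) \<union> set (filter (\<lambda>z. z = x \<or> z = y) v))"
      using \<open>x \<noteq> y\<close> \<open>a \<noteq> b\<close> by (auto simp: g_def inj_on_def)
    ultimately show ?thesis
      unfolding val by (simp only: inj_on_map_eq_map)
  qed
  show "u = v"
  proof (rule word_determined_by_pair_restrictions)
    fix x y :: var assume "x \<noteq> y"
    define p where "p = filter (\<lambda>z. z = x \<or> z = y) u"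
    have "p = [] \<or> hd p = x \<or> hd p = y"
      using hd_in_set[of p] by (auto simp: p_def)
    moreover have swap: "filter (\<lambda>z. z = x \<or> z = y) w = filter (\<lambda>z. z = y \<or> z = x) w" for w
      by (simp only: disj_commute)
    ultimately show "filter (\<lambda>z. z = x \<or> z = y) u = filter (\<lambda>z. z = x \<or> z = y) v"
      using restrict[of x y] restrict[of y x] \<open>x \<noteq> y\<close> unfolding p_def swap[symmetric] by metis
  qed
qed

section \<open>Isoterms and generated varieties\<close>

lemma (in monoid) word_value_closed:
  assumes "\<phi> \<in> UNIV \<rightarrow> carrier G"
  shows "word_value G \<phi> w \<in> carrier G"
  using assms by (induction w) auto

lemma (in monoid) word_value_append:
  assumes "\<phi> \<in> UNIV \<rightarrow> carrier G"
  shows "word_value G \<phi> (u @ v) = word_value G \<phi> u \<otimes> word_value G \<phi> v"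
proof (induction u)
  case (Cons x u)
  then show ?case
    using funcset_mem[OF assms] word_value_closed[OF assms] by (simp add: m_assoc)
qed (simp add: word_value_closed[OF assms])

lemma (in monoid) isoterm_sublist:
  assumes "isoterm G w" and "sublist u w"
  shows "isoterm G u"
  unfolding isoterm_def
proof (intro allI impI)
  fix v assume "satisfies G u v"
  obtain p s where w: "w = p @ u @ s"
    using assms(2) by (auto simp: sublist_def)
  have "satisfies G w (p @ v @ s)"
    using \<open>satisfies G u v\<close> unfolding satisfies_def w by (simp add: word_value_append)
  then show "u = v"
    using assms(1) by (auto simp: isoterm_def w)
qed

text \<open>
  The monoid of all evaluation maps of words, indexed by the assignments into \<open>G\<close>, is a submonoid of a
  power of \<open>G\<close>, and it is relatively free. Two words with the same evaluation map form an identity of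
  \<open>G\<close>, so if one of them is a subword of \<open>W\<close>, hence an isoterm, they are equal. Sending evaluation
  maps to classes is therefore a well-defined homomorphism onto \<open>S1 W\<close>. The proof carries this out in
  all coordinates of a power of \<open>S1 W\<close> at once, because the members of the generated variety are
  images of subsemigroups of such powers.
\<close>

lemma (in monoid) generated_variety_S1_subset:
  assumes "\<And>w. w \<in> W \<Longrightarrow> isoterm G w"
  shows "(generated_variety (S1 W) :: 'u monoid set) \<subseteq> generated_variety G"
proof
  fix T :: "'u monoid"
  assume "T \<in> generated_variety (S1 W)"
  then obtain I :: "('u \<Rightarrow> var list set) set" and H h where
    H: "subsemigroup H (product_group I (\<lambda>_. S1 W))"
    and h: "h \<in> hom (product_group I (\<lambda>_. S1 W) \<lparr>carrier := H\<rparr>) T"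
    and surj: "h ` H = carrier T"
    unfolding generated_variety_def by blast
  define J where "J = I \<times> (UNIV \<rightarrow> carrier G :: (var \<Rightarrow> 'a) set)"
  \<comment> \<open>A family \<open>w\<close> of words, one per coordinate, is mapped to its evaluations by \<open>E\<close> and to its
    classes by \<open>C\<close>; the homomorphism \<open>r\<close> takes \<open>E w\<close> to \<open>C w\<close>.\<close>
  define E where "E w = (\<lambda>j\<in>J. word_value G (snd j) (w (fst j)))" for w :: "_ \<Rightarrow> var list"
  define C where "C w = (\<lambda>i\<in>I. word_class W (w i))" for w
  define K where "K = {E w |w. C w \<in> H}"
  define r where "r f = C (SOME w. E w = f)" for f
  have class_eq: "word_class W u = word_class W v" if "satisfies G u v" for u v
  proof -
    have iso: "isoterm G u" if "\<exists>w\<in>W. sublist u w" for u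
      using that assms isoterm_sublist by blast
    have "satisfies G v u"
      using that by (auto simp: satisfies_def)
    then show ?thesis
      using iso[of u] iso[of v] that unfolding word_class_eq_iff isoterm_def by blast
  qed
  have EC: "C w = C w'" if "E w = E w'" for w w'
  proof -
    have "satisfies G (w i) (w' i)" if "i \<in> I" for i
      unfolding satisfies_def
    proof
      fix \<phi> :: "var \<Rightarrow> 'a" assume "\<phi> \<in> UNIV \<rightarrow> carrier G"
      then have "(i, \<phi>) \<in> J"
        using that by (simp add: J_def)
      then show "word_value G \<phi> (w i) = word_value G \<phi> (w' i)"
        using fun_cong[OF \<open>E w = E w'\<close>, of "(i, \<phi>)"] by (simp add: E_def)
    qed
    then show ?thesis
      unfolding C_def by (intro restrict_ext class_eq)
  qed
  have rE: "r (E w) = C w" for w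
    unfolding r_def by (rule EC, rule someI[of "\<lambda>w'. E w' = E w"], rule refl)
  have E_mult: "E w \<otimes>\<^bsub>product_group J (\<lambda>_. G)\<^esub> E w' = E (\<lambda>i. w i @ w' i)" for w w'
    by (auto simp: product_group_def E_def J_def word_value_append intro!: restrict_ext)
  have C_mult: "C w \<otimes>\<^bsub>product_group I (\<lambda>_. S1 W)\<^esub> C w' = C (\<lambda>i. w i @ w' i)" for w w'
    by (auto simp: product_group_def C_def mult_S1 intro!: restrict_ext)
  have C_surj: "\<exists>w. p = C w" if "p \<in> H" for p
  proof -
    have p: "p \<in> (\<Pi>\<^sub>E i\<in>I. carrier (S1 W))"
      using H that by (auto simp: subsemigroup_def)
    then have "\<forall>i\<in>I. \<exists>w. p i = word_class W w"
      unfolding carrier_S1 by (blast dest: PiE_mem)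
    then obtain w where "\<forall>i\<in>I. p i = word_class W (w i)"
      by metis
    then have "p = C w"
      using p by (intro ext) (auto simp: C_def PiE_def extensional_def)
    then show ?thesis
      by blast
  qed
  show "T \<in> generated_variety G"
  proof (rule in_generated_varietyI)
    show "subsemigroup K (product_group J (\<lambda>_. G))"
      unfolding subsemigroup_def
    proof (intro conjI ballI)
      have "H \<noteq> {}"
        using H by (simp add: subsemigroup_def)
      then show "K \<noteq> {}"
        using C_surj unfolding K_def by blast
      have "E w \<in> (\<Pi>\<^sub>E j\<in>J. carrier G)" for w
        unfolding E_def
        by (intro restrict_PiE_iff[THEN iffD2] ballI word_value_closed) (auto simp: J_def)
      then show "K \<subseteq> carrier (product_group J (\<lambda>_. G))"
        by (auto simp only: K_def carrier_product_group)
      fix f g assume "f \<in> K" "g \<in> K"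
      then obtain w w' where "f = E w" "C w \<in> H" "g = E w'" "C w' \<in> H"
        by (auto simp: K_def)
      moreover from this have "C (\<lambda>i. w i @ w' i) \<in> H"
        using H unfolding C_mult[symmetric] by (simp add: subsemigroup_def)
      ultimately show "f \<otimes>\<^bsub>product_group J (\<lambda>_. G)\<^esub> g \<in> K"
        using E_mult by (auto simp: K_def)
    qed
    have hC: "h (C (\<lambda>i. w i @ w' i)) = h (C w) \<otimes>\<^bsub>T\<^esub> h (C w')" if "C w \<in> H" "C w' \<in> H" for w w'
      using h that unfolding C_mult[symmetric] by (simp add: hom_def)
    show "h \<circ> r \<in> hom (product_group J (\<lambda>_. G)\<lparr>carrier := K\<rparr>) T"
    proof (rule homI)
      fix f assume "f \<in> carrier (product_group J (\<lambda>_. G)\<lparr>carrier := K\<rparr>)"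
      then show "(h \<circ> r) f \<in> carrier T"
        using surj by (auto simp: K_def rE)
    next
      fix f g
      assume "f \<in> carrier (product_group J (\<lambda>_. G)\<lparr>carrier := K\<rparr>)"
        and "g \<in> carrier (product_group J (\<lambda>_. G)\<lparr>carrier := K\<rparr>)"
      then obtain w w' where "f = E w" "C w \<in> H" "g = E w'" "C w' \<in> H"
        by (auto simp: K_def)
      then show "(h \<circ> r) (f \<otimes>\<^bsub>product_group J (\<lambda>_. G)\<lparr>carrier := K\<rparr>\<^esub> g)
          = (h \<circ> r) f \<otimes>\<^bsub>T\<^esub> (h \<circ> r) g"
        using E_mult[of w w'] hC by (simp add: rE)
    qed
    have "r ` K = H"
    proof
      show "r ` K \<subseteq> H"
        by (auto simp: K_def rE)
      show "H \<subseteq> r ` K"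
      proof
        fix p assume "p \<in> H"
        moreover then obtain w where "p = C w"
          using C_surj by blast
        ultimately have "E w \<in> K" "p = r (E w)"
          by (auto simp: K_def rE)
        then show "p \<in> r ` K"
          by blast
      qed
    qed
    then show "(h \<circ> r) ` K = carrier T"
      using surj by (simp only: image_comp[symmetric])
  qed
qed

lemma equationally_equivalentI:
  assumes "\<And>w. w \<in> W \<Longrightarrow> isoterm (S1 W') w" and "\<And>w. w \<in> W' \<Longrightarrow> isoterm (S1 W) w"
  shows "equationally_equivalent TYPE('u) W W'"
  unfolding equationally_equivalent_def
  using monoid.generated_variety_S1_subset[OF monoid_S1] assms by blast

section \<open>Words with boundedly many occurrences of each variable\<close>

text \<open>
  The set \<open>{u. \<forall>x. count_list u x \<le> m}\<close> is \<open>Isot (L1 l)\<close> for \<open>m = l div 2\<close> and \<open>2 \<le> l \<le> 5\<close>. Its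
  elements are isoterms for \<open>S1 W\<close> by the reduction to pairs, while \<open>W\<close> is contained in it, and every
  word of a set is an isoterm for the monoid of that set.
\<close>

lemma equationally_equivalent_bounded_occurrences:
  fixes a b :: var
  assumes "a \<noteq> b"
    and "\<And>p. set p \<subseteq> {a, b} \<Longrightarrow> (p \<noteq> [] \<Longrightarrow> hd p = a) \<Longrightarrow> count_list p a \<le> m \<Longrightarrow>
      count_list p b \<le> m \<Longrightarrow> \<exists>w\<in>W. sublist p w"
    and "\<And>w x. w \<in> W \<Longrightarrow> count_list w x \<le> m"
  shows "equationally_equivalent TYPE('u) {u. \<forall>x. count_list u x \<le> m} W"
proof (rule equationally_equivalentI)
  fix w :: "var list" assume "w \<in> {u. \<forall>x. count_list u x \<le> m}"
  then show "isoterm (S1 W) w"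
    using isoterm_S1_pairs[OF assms(1), of m W w] assms(2) by blast
next
  fix w assume "w \<in> W"
  then show "isoterm (S1 {u. \<forall>x. count_list u x \<le> m}) w"
    using assms(3) by (intro isoterm_S1_self) auto
qed

lemma length_two_letter_word:
  assumes "a \<noteq> b" and "set p \<subseteq> {a, b}"
  shows "length p = count_list p a + count_list p b"
  using assms by (induction p) auto

theorem fact6p1:
  fixes a b :: var
  assumes "a \<noteq> b"
  shows "(Isot (L1 2) = Isot (L1 3) \<and>
          equationally_equivalent TYPE('u) (Isot (L1 3)) {[a, b]}) \<and>
         (Isot (L1 4) = Isot (L1 5) \<and>
          equationally_equivalent TYPE('u) (Isot (L1 5))
            {[a, b, a, b], [a, a, b, b], [a, b, b, a]})"
proof -
  have "\<exists>w\<in>{[a, b]}. sublist p w"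
    if "set p \<subseteq> {a, b}" "p \<noteq> [] \<Longrightarrow> hd p = a" "count_list p a \<le> 1" "count_list p b \<le> 1" for p
  proof -
    have "length p \<le> 2"
      using length_two_letter_word[OF assms that(1)] that(3,4) by linarith
    then have "p = [] \<or> (\<exists>x. p = [x]) \<or> (\<exists>x y. p = [x, y])"
      by (cases p rule: remdups_adj.cases) auto
    then show ?thesis
      using that assms by (auto simp: sublist_Cons_right split: if_splits)
  qed
  then have one: "equationally_equivalent TYPE('u) {u. \<forall>x. count_list u x \<le> 1} {[a, b]}"
    using assms by (intro equationally_equivalent_bounded_occurrences[of a b]) auto
  have "\<exists>w\<in>{[a, b, a, b], [a, a, b, b], [a, b, b, a]}. sublist p w"
    if "set p \<subseteq> {a, b}" "p \<noteq> [] \<Longrightarrow> hd p = a" "count_list p a \<le> 2" "count_list p b \<le> 2" for p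
  proof -
    have "length p \<le> 4"
      using length_two_letter_word[OF assms that(1)] that(3,4) by linarith
    then have "p = [] \<or> (\<exists>x. p = [x]) \<or> (\<exists>x y. p = [x, y]) \<or> (\<exists>x y z. p = [x, y, z]) \<or>
        (\<exists>x y z t. p = [x, y, z, t])"
      by (auto simp: le_Suc_eq numeral_eq_Suc length_Suc_conv)
    then show ?thesis
      using that assms by (auto simp: sublist_Cons_right split: if_splits)
  qed
  then have two: "equationally_equivalent TYPE('u) {u. \<forall>x. count_list u x \<le> 2}
      {[a, b, a, b], [a, a, b, b], [a, b, b, a]}"
    using assms by (intro equationally_equivalent_bounded_occurrences[of a b]) auto
  show ?thesis
    using one two by (simp add: Isot_L1)
qed

end
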